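(* Let $E$ be a Banach lattice and let $\mathcal{T} = (T_t)_{t \in J}$ be a positive semigroup on $E$, where either $J = \mathbb{N}$ or $J = (0,\infty)$. Assume that there exists a strictly positive functional $\psi \in E'_+$ such that $T'_t\psi \le M \psi$ for a constant $M>0$ and all $t \in J$. If $\mathcal{T}$ has relatively compact orbits and a non-zero lower bound with respect to $\psi$, then $\mathcal{T}$ converges strongly (as $t\to\infty$) to a rank-$1$ projection.
   Context: All spaces are real. $\mathbb{N} = \{1,2,\dots\}$. $E_+$ is the positive cone of $E$, $E'$ the dual Banach lattice, and $T'$ the adjoint of $T$. A functional $\psi \in E'$ is strictly positive if $\langle\psi,f\rangle>0$ for all $f\ge 0$, $f\neq 0$. A semigroup on $E$ is a family $(T_t)_{t \in J}$ of bounded linear operators on $E$ with $T_{t+s} = T_tT_s$ for all $s,t \in J$; no continuity in $t$ is assumed. It is positive if $T_tE_+\subseteq E_+$ for all $t \in J$. It has relatively compact orbits if for each $f\in E$ the set $\{T_tf : t\in J\}$ is relatively compact in norm. Strong convergence means convergence in the strong operator topology. For $\psi \in E'_+$, a vector $h\in E_+$ is a lower bound for $\mathcal{T}$ with respect to $\psi$ if $\langle\psi,(T_tf-h)^-\rangle\to 0$ as $t\to\infty$ for every $f\in E_+$ with $\langle\psi,f\rangle=1$; here $g^- = (-g)\vee 0$. *)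

theory Defs
  imports "HOL-Analysis.Analysis" "HOL-Library.Lattice_Algebras"
begin

text \<open>Real Banach lattices: complete normed vector lattices whose norm is a lattice norm.\<close>

class banach_lattice = banach + ordered_real_vector + lattice_ab_group_add_abs +
  assumes lattice_norm: "\<bar>x\<bar> \<le> \<bar>y\<bar> \<Longrightarrow> norm x \<le> norm y"

instance real :: banach_lattice
  by standard simp

definition neg_part :: "'a::banach_lattice \<Rightarrow> 'a" where
  "neg_part g = sup (- g) 0"

definition positive_operator ::
    "('a::banach_lattice \<Rightarrow>\<^sub>L 'b::banach_lattice) \<Rightarrow> bool" where
  "positive_operator A \<longleftrightarrow> (\<forall>f\<ge>0. 0 \<le> blinfun_apply A f)"

text \<open>The order of the dual Banach lattice.\<close>

definition dual_le ::
    "('a::banach_lattice \<Rightarrow>\<^sub>L real) \<Rightarrow> ('a \<Rightarrow>\<^sub>L real) \<Rightarrow> bool" where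
  "dual_le \<phi> \<psi> \<longleftrightarrow> (\<forall>f\<ge>0. blinfun_apply \<phi> f \<le> blinfun_apply \<psi> f)"

definition strictly_positive_functional :: "('a::banach_lattice \<Rightarrow>\<^sub>L real) \<Rightarrow> bool" where
  "strictly_positive_functional \<psi> \<longleftrightarrow> (\<forall>f\<ge>0. f \<noteq> 0 \<longrightarrow> 0 < blinfun_apply \<psi> f)"

text \<open>The Banach space adjoint (the library's \<open>adjoint\<close> is the Hilbert space one).\<close>

definition dual_operator ::
    "('a::banach_lattice \<Rightarrow>\<^sub>L 'b::banach_lattice) \<Rightarrow> ('b \<Rightarrow>\<^sub>L real) \<Rightarrow> ('a \<Rightarrow>\<^sub>L real)" where
  "dual_operator A \<phi> = \<phi> o\<^sub>L A"

text \<open>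
  Operator families are indexed by a time set \<open>J\<close> of reals, so that the discrete case
  \<open>J = {1, 2, \<dots>}\<close> and the continuous case \<open>J = {0<..}\<close> are treated together. The values of
  \<open>T\<close> outside \<open>J\<close> are irrelevant, and the filter \<open>infinity_in J\<close> describes \<open>t \<rightarrow> \<infinity>\<close> within \<open>J\<close>.
\<close>

definition infinity_in :: "real set \<Rightarrow> real filter" where
  "infinity_in J = inf at_top (principal J)"

definition operator_semigroup ::
    "real set \<Rightarrow> (real \<Rightarrow> 'a::banach_lattice \<Rightarrow>\<^sub>L 'a) \<Rightarrow> bool" where
  "operator_semigroup J T \<longleftrightarrow> (\<forall>s\<in>J. \<forall>t\<in>J. T (t + s) = T t o\<^sub>L T s)"

definition positive_semigroup ::
    "real set \<Rightarrow> (real \<Rightarrow> 'a::banach_lattice \<Rightarrow>\<^sub>L 'a) \<Rightarrow> bool" where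
  "positive_semigroup J T \<longleftrightarrow> operator_semigroup J T \<and> (\<forall>t\<in>J. positive_operator (T t))"

definition relatively_compact_orbits ::
    "real set \<Rightarrow> (real \<Rightarrow> 'a::banach_lattice \<Rightarrow>\<^sub>L 'a) \<Rightarrow> bool" where
  "relatively_compact_orbits J T \<longleftrightarrow> (\<forall>f. compact (closure ((\<lambda>t. blinfun_apply (T t) f) ` J)))"

definition lower_bound ::
    "real set \<Rightarrow> (real \<Rightarrow> 'a::banach_lattice \<Rightarrow>\<^sub>L 'a) \<Rightarrow> ('a \<Rightarrow>\<^sub>L real) \<Rightarrow> 'a \<Rightarrow> bool" where
  "lower_bound J T \<psi> h \<longleftrightarrow> 0 \<le> h \<and>
     (\<forall>f\<ge>0. blinfun_apply \<psi> f = 1 \<longrightarrow>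
        ((\<lambda>t. blinfun_apply \<psi> (neg_part (blinfun_apply (T t) f - h))) \<longlongrightarrow> 0) (infinity_in J))"

definition converges_strongly ::
    "real set \<Rightarrow> (real \<Rightarrow> 'a::banach_lattice \<Rightarrow>\<^sub>L 'a) \<Rightarrow> ('a \<Rightarrow>\<^sub>L 'a) \<Rightarrow> bool" where
  "converges_strongly J T P \<longleftrightarrow> limitin strong_operator_topology T P (infinity_in J)"

text \<open>
  \<^const>\<open>dim\<close> is the cardinality of a basis and hence \<open>0\<close> on infinite-dimensional spaces, so
  \<open>dim V = 1\<close> does say that \<open>V\<close> is one-dimensional.
\<close>

definition rank_one_projection :: "('a::banach_lattice \<Rightarrow>\<^sub>L 'a) \<Rightarrow> bool" where
  "rank_one_projection P \<longleftrightarrow> P o\<^sub>L P = P \<and> dim (range (blinfun_apply P)) = 1"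

end

theory Submission
  imports Defs
begin

text \<open>
  The functional \<open>\<psi>\<close> turns \<open>E\<close> into a normed space with the weaker norm \<open>f \<mapsto> \<psi> \<bar>f\<bar>\<close>, in
  which the semigroup is bounded by \<open>M\<close>. On the relatively compact orbits this norm and the
  given one define the same topology, so convergence may be proved in the weaker norm, where
  the positive cone behaves almost like the one of an \<open>L\<^sup>1\<close>-space; what is missing is that the
  norm be preserved by the semigroup on positive vectors.

  This is repaired by a Banach limit: averaging \<open>n \<mapsto> \<psi> (T n f)\<close> yields a positive functional
  \<open>\<phi> \<le> M \<psi>\<close> with \<open>\<phi> (T 1 f) = \<phi> f\<close>. Asymptotically \<open>T n f \<ge> \<psi> f h\<close> for \<open>f \<ge> 0\<close>, and applying
  \<open>\<phi>\<close> to this gives \<open>\<phi> f \<ge> \<psi> f \<phi> h\<close>. Moreover \<open>\<phi> h > 0\<close>, because \<open>\<psi> (T n h)\<close> is eventually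
  bounded below by nearly \<open>(\<psi> h)\<^sup>2\<close>. Hence \<open>f \<mapsto> \<phi> \<bar>f\<bar>\<close> is a norm equivalent to \<open>f \<mapsto> \<psi> \<bar>f\<bar>\<close>;
  it is additive on the positive cone and preserved there by \<open>T 1\<close>.

  Now Lasota's lower bound argument applies. If \<open>\<phi> f = 0\<close>, the positive and the negative part of
  \<open>f\<close> have the same mass \<open>a = \<phi> \<bar>f\<bar> / 2\<close>, and both of their orbits eventually lie, up to small
  errors, above \<open>(a / M) h\<close>. This common part cancels in \<open>T n f\<close>, so that the limit \<open>l\<close> of the
  decreasing sequence \<open>\<phi> \<bar>T n f\<bar>\<close> satisfies \<open>l \<le> (1 - \<phi> h / M) \<phi> \<bar>f\<bar>\<close>. Replacing \<open>f\<close> by \<open>T m f\<close>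
  and letting \<open>m\<close> grow gives \<open>l \<le> (1 - \<phi> h / M) l\<close>, hence \<open>l = 0\<close>. Therefore \<open>T t f \<rightarrow> 0\<close> as
  \<open>t \<rightarrow> \<infinity>\<close> whenever \<open>\<phi> f = 0\<close> (lemma \<open>T_tendsto_0\<close>).

  It remains to find a fixed vector \<open>g\<close> with \<open>\<phi> g \<noteq> 0\<close>, since then \<open>T t f\<close> converges to
  \<open>(\<phi> f / \<phi> g) g\<close>. A cluster point \<open>g\<close> of \<open>T n h\<close> works: \<open>\<phi> (T 1 h - h) = 0\<close> implies
  \<open>T 1 g = g\<close>, and \<open>\<phi> g = \<phi> h\<close>. For non-integer times, the orbit of \<open>T t g - (\<phi> (T t g) / \<phi> g) g\<close>
  under the powers of \<open>T 1\<close> is constant and tends to \<open>0\<close>, so that \<open>T t g = c t g\<close> with a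
  multiplicative, bounded function \<open>c\<close> that is \<open>1\<close> at the integers. Such a \<open>c\<close> is \<open>1\<close>
  everywhere.
\<close>

section \<open>Banach limits\<close>

lemma abs_Cesaro_mean_le:
  fixes x :: "nat \<Rightarrow> real"
  assumes "\<And>k. \<bar>x k\<bar> \<le> b"
  shows "\<bar>(\<Sum>k<n. x k) / real n\<bar> \<le> b"
proof (cases "n = 0")
  case False
  have "\<bar>\<Sum>k<n. x k\<bar> \<le> (\<Sum>k<n. b)"
    by (rule order_trans[OF sum_abs]) (intro sum_mono assms)
  then show ?thesis
    using False by (simp add: field_simps)
qed (use assms[of 0] in simp)

text \<open>
  The difference of the two sums telescopes to \<open>x n - x 0\<close>, a bounded quantity that the
  division by \<open>n\<close> suppresses. This makes limits of Cesaro means shift invariant.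
\<close>

lemma Cesaro_mean_shift:
  fixes x :: "nat \<Rightarrow> real"
  assumes "Bseq x"
  shows "(\<lambda>n. (\<Sum>k<n. x (Suc k)) / real n - (\<Sum>k<n. x k) / real n) \<longlonglongrightarrow> 0"
proof -
  from assms obtain b where b: "\<And>k. \<bar>x k\<bar> \<le> b"
    unfolding Bseq_def by auto
  have "(\<Sum>k<n. x (Suc k)) / real n - (\<Sum>k<n. x k) / real n = (x n - x 0) / real n" for n
    using sum_lessThan_telescope[of x n] by (simp add: sum_subtractf flip: diff_divide_distrib)
  moreover have "(\<lambda>n. (x n - x 0) / real n) \<longlonglongrightarrow> 0"
  proof (rule Lim_null_comparison)
    have "\<bar>x n - x 0\<bar> \<le> 2 * b" for n
      using b[of n] b[of 0] by linarith
    then show "\<forall>\<^sub>F n in sequentially. norm ((x n - x 0) / real n) \<le> 2 * b / real n"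
      by (intro always_eventually) (auto intro!: divide_right_mono)
    show "(\<lambda>n. 2 * b / real n) \<longlonglongrightarrow> 0"
      by (rule lim_const_over_n)
  qed
  ultimately show ?thesis
    by simp
qed

text \<open>
  A Banach limit, obtained as a limit of the Cesaro means along a filter \<open>G\<close> finer than
  \<open>sequentially\<close>. The \<open>n\<close>-th mean, as a function of the sequence, is a point of a product of
  compact intervals; Tychonoff's theorem gives a cluster point \<open>L\<close> of these points, and \<open>G\<close>
  restricts \<open>sequentially\<close> to the neighbourhoods of \<open>L\<close>. All properties of \<open>L\<close> follow by
  passing to the limit along \<open>G\<close>.
\<close>

lemma banach_limit_exists:
  obtains L :: "(nat \<Rightarrow> real) \<Rightarrow> real" where
    "\<And>x y. Bseq x \<Longrightarrow> Bseq y \<Longrightarrow> L (\<lambda>n. x n + y n) = L x + L y"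
    "\<And>c x. Bseq x \<Longrightarrow> L (\<lambda>n. c * x n) = c * L x"
    "\<And>x. Bseq x \<Longrightarrow> L (\<lambda>n. x (Suc n)) = L x"
    "\<And>x a. Bseq x \<Longrightarrow> (\<And>n. a \<le> x n) \<Longrightarrow> a \<le> L x"
proof -
  define A :: "nat \<Rightarrow> (nat \<Rightarrow> real) \<Rightarrow> real"
    \<comment> \<open>The value \<open>0\<close> off the bounded sequences keeps every coordinate in a compact interval.\<close>
    where "A n x = (if Bseq x then (\<Sum>k<n. x k) / real n else 0)" for n x
  have "\<exists>b. \<forall>n. A n x \<in> {- b..b}" for x
  proof (cases "Bseq x")
    case True
    then obtain b where "\<And>k. \<bar>x k\<bar> \<le> b"
      unfolding Bseq_def by auto
    then have "\<bar>A n x\<bar> \<le> b" for n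
      using True abs_Cesaro_mean_le[of x b n] by (simp add: A_def)
    then show ?thesis
      by (auto simp: abs_le_iff minus_le_iff intro!: exI[of _ b])
  qed (auto simp: A_def intro!: exI[of _ 0])
  then obtain b where b: "\<And>n x. A n x \<in> {- b x..b x}"
    by metis
  have "compact (PiE UNIV (\<lambda>x. {- b x..b x}))"
    using compactin_PiE[of "\<lambda>_. euclideanreal" UNIV "\<lambda>x. {- b x..b x}"]
    by (simp add: euclidean_product_topology)
  moreover have "eventually (\<lambda>f. f \<in> PiE UNIV (\<lambda>x. {- b x..b x})) (filtermap A sequentially)"
    unfolding eventually_filtermap using b by (intro always_eventually) (auto simp: PiE_iff)
  moreover have "filtermap A sequentially \<noteq> bot"
    by (simp add: filtermap_bot_iff)
  ultimately obtain L where L: "inf (nhds L) (filtermap A sequentially) \<noteq> bot"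
    unfolding compact_filter by blast
  \<comment> \<open>Along \<open>G\<close>, the Cesaro means of all bounded sequences converge at once.\<close>
  define G where "G = inf sequentially (filtercomap A (nhds L))"
  have "G \<noteq> bot"
  proof
    assume "G = bot"
    then have "eventually (\<lambda>_. False) G"
      by simp
    then obtain P Q where P: "eventually P sequentially" and Q: "eventually Q (nhds L)"
      and PQ: "\<And>n. P n \<Longrightarrow> Q (A n) \<Longrightarrow> False"
      unfolding G_def eventually_inf eventually_filtercomap by metis
    have "eventually (\<lambda>f. \<not> Q f) (filtermap A sequentially)"
      unfolding eventually_filtermap using P by eventually_elim (use PQ in auto)
    then have "eventually (\<lambda>_. False) (inf (nhds L) (filtermap A sequentially))"
      using Q unfolding eventually_inf by blast
    with L show False
      by (simp add: eventually_False)
  qed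
  have G: "G \<le> sequentially"
    by (simp add: G_def)
  have AL: "(A \<longlongrightarrow> L) G"
    by (rule filterlim_mono[OF filterlim_filtercomap order_refl]) (simp add: G_def)
  have lim: "((\<lambda>n. A n x) \<longlongrightarrow> L x) G" for x
    using continuous_on_tendsto_compose[OF continuous_on_product_coordinates[of x] AL] by simp
  have "L (\<lambda>n. x n + y n) = L x + L y" if *: "Bseq x" "Bseq y" for x y
  proof -
    from * obtain b c where "\<And>k. \<bar>x k\<bar> \<le> b" "\<And>k. \<bar>y k\<bar> \<le> c"
      unfolding Bseq_def by auto
    then have "Bseq (\<lambda>n. x n + y n)"
      by (intro BseqI'[of _ "b + c"]) (simp add: order_trans[OF abs_triangle_ineq] add_mono)
    then have "A n (\<lambda>n. x n + y n) = A n x + A n y" for n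
      using * by (simp add: A_def sum.distrib add_divide_distrib)
    with lim[of "\<lambda>n. x n + y n"] tendsto_add[OF lim[of x] lim[of y]] show ?thesis
      using tendsto_unique[OF \<open>G \<noteq> bot\<close>] by simp
  qed
  moreover have "L (\<lambda>n. c * x n) = c * L x" if *: "Bseq x" for c x
  proof -
    have "Bseq (\<lambda>n. c * x n)"
      using * Bseq_mult[of "\<lambda>_. c" x] by simp
    then have "A n (\<lambda>n. c * x n) = c * A n x" for n
      using * by (simp add: A_def sum_distrib_left)
    with lim[of "\<lambda>n. c * x n"] tendsto_mult_left[OF lim[of x], of c] show ?thesis
      using tendsto_unique[OF \<open>G \<noteq> bot\<close>] by simp
  qed
  moreover have "L (\<lambda>n. x (Suc n)) = L x" if *: "Bseq x" for x
  proof -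
    from * have Suc: "Bseq (\<lambda>n. x (Suc n))"
      by (simp add: Bseq_Suc_iff)
    have "((\<lambda>n. A n (\<lambda>n. x (Suc n)) - A n x) \<longlongrightarrow> 0) G"
      using tendsto_mono[OF G Cesaro_mean_shift[OF *]] * Suc by (simp add: A_def)
    with tendsto_diff[OF lim[of "\<lambda>n. x (Suc n)"] lim[of x]]
    have "L (\<lambda>n. x (Suc n)) - L x = 0"
      using tendsto_unique[OF \<open>G \<noteq> bot\<close>] by blast
    then show ?thesis
      by simp
  qed
  moreover have "a \<le> L x" if *: "Bseq x" "\<And>n. a \<le> x n" for a x
  proof -
    have "a \<le> A n x" if "n > 0" for n
    proof -
      have "(\<Sum>k<n. a) \<le> (\<Sum>k<n. x k)"
        by (intro sum_mono *)
      then show ?thesis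
        using * that by (simp add: A_def field_simps)
    qed
    then have "eventually (\<lambda>n. a \<le> A n x) G"
      by (intro filter_leD[OF G] eventually_mono[OF eventually_gt_at_top[of 0]])
    then show ?thesis
      by (intro tendsto_lowerbound[OF lim[of x] _ \<open>G \<noteq> bot\<close>])
  qed
  ultimately show thesis
    by (rule that)
qed

section \<open>Absolute values and negative parts in Banach lattices\<close>

lemma abs_eq_pprt_add_pprt_uminus: "\<bar>f\<bar> = pprt f + pprt (- f)"
  for f :: "'a::banach_lattice"
  by (simp add: abs_prts pprt_neg)

lemma eq_pprt_diff_pprt_uminus: "f = pprt f - pprt (- f)"
  for f :: "'a::banach_lattice"
  using prts[of f] by (simp add: pprt_neg)

lemma neg_part_eq_pprt: "neg_part g = pprt (- g)"
  by (simp add: neg_part_def pprt_def)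

lemma neg_part_nonneg: "0 \<le> neg_part g"
  by (simp add: neg_part_eq_pprt)

lemma uminus_neg_part_le: "- neg_part g \<le> g"
  by (simp add: neg_part_eq_pprt pprt_neg nprt_def)

lemma neg_part_antimono: "f \<le> g \<Longrightarrow> neg_part g \<le> neg_part f"
  unfolding neg_part_eq_pprt by (intro pprt_mono) simp

lemma abs_eq_add_neg_part: "\<bar>g\<bar> = g + 2 *\<^sub>R neg_part g"
  using eq_pprt_diff_pprt_uminus[of g] unfolding abs_eq_pprt_add_pprt_uminus neg_part_eq_pprt
  by (metis (no_types, lifting) add.commute add_diff_cancel_left' diff_add_eq scaleR_2 add_diff_eq)

lemma norm_abs_lattice: "norm \<bar>f\<bar> = norm f"
  for f :: "'a::banach_lattice"
  by (intro antisym lattice_norm) simp_all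

text \<open>
  One inequality holds by minimality of the supremum; it yields the other one when applied to
  the scalar \<open>1 / c\<close>.
\<close>

lemma neg_part_scaleR:
  assumes "0 < c"
  shows "neg_part (c *\<^sub>R g) = c *\<^sub>R neg_part g"
proof -
  have le: "neg_part (a *\<^sub>R f) \<le> a *\<^sub>R neg_part f" if "0 \<le> a" for a and f :: 'a
  proof -
    have "- (a *\<^sub>R f) = a *\<^sub>R (- f)"
      by simp
    also have "\<dots> \<le> a *\<^sub>R neg_part f"
      using that by (intro scaleR_left_mono) (simp_all add: neg_part_def)
    finally show ?thesis
      using that by (simp add: neg_part_def[of "a *\<^sub>R f"] scaleR_nonneg_nonneg neg_part_nonneg)
  qed
  have "c *\<^sub>R neg_part ((1 / c) *\<^sub>R (c *\<^sub>R g)) \<le> c *\<^sub>R ((1 / c) *\<^sub>R neg_part (c *\<^sub>R g))"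
    using assms by (intro scaleR_left_mono le) simp_all
  then show ?thesis
    using assms le[of c g] by (simp add: antisym)
qed

lemma abs_scaleR_pos: "0 < c \<Longrightarrow> \<bar>c *\<^sub>R g\<bar> = c *\<^sub>R \<bar>g\<bar>"
  for g :: "'a::banach_lattice"
  by (simp add: abs_eq_add_neg_part neg_part_scaleR scaleR_add_right)

lemma continuous_on_abs_lattice: "continuous_on S (\<lambda>f :: 'a::banach_lattice. \<bar>f\<bar>)"
proof -
  have "dist \<bar>f\<bar> \<bar>g\<bar> \<le> dist f g" for f g :: 'a
    unfolding dist_norm by (intro lattice_norm abs_triangle_ineq3)
  then show ?thesis
    unfolding continuous_on_iff by (meson le_less_trans)
qed

lemma positive_operator_mono:
  "positive_operator A \<Longrightarrow> f \<le> g \<Longrightarrow> blinfun_apply A f \<le> blinfun_apply A g"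
  unfolding positive_operator_def by (metis blinfun.diff_right diff_ge_0_iff_ge)

lemma positive_operator_abs_le:
  assumes "positive_operator A"
  shows "\<bar>blinfun_apply A f\<bar> \<le> blinfun_apply A \<bar>f\<bar>"
  using positive_operator_mono[OF assms, of f "\<bar>f\<bar>"] positive_operator_mono[OF assms, of "- f" "\<bar>f\<bar>"]
  by (simp add: abs_ge_self abs_ge_minus_self abs_leI blinfun.minus_right)

section \<open>Convergence on compact sets and in the strong operator topology\<close>

text \<open>
  On a compact set, a continuous function that is positive except at \<open>a\<close> detects convergence
  to \<open>a\<close>, since it is bounded away from \<open>0\<close> outside every neighbourhood of \<open>a\<close>. With
  \<open>p f = \<psi> \<bar>f\<bar>\<close> and \<open>K\<close> the closure of an orbit, this upgrades convergence in the weak norm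
  given by \<open>\<psi>\<close> to norm convergence.
\<close>

lemma tendsto_if_compact_separated:
  fixes x :: "'b \<Rightarrow> 'a::metric_space" and p :: "'a \<Rightarrow> real"
  assumes "compact K" "continuous_on K p" "\<And>y. y \<in> K \<Longrightarrow> p y \<le> 0 \<Longrightarrow> y = a"
    and in_K: "eventually (\<lambda>t. x t \<in> K) F" and lim: "((\<lambda>t. p (x t)) \<longlongrightarrow> 0) F"
  shows "(x \<longlongrightarrow> a) F"
proof (rule topological_tendstoI)
  fix U assume U: "open U" "a \<in> U"
  have "compact (K - U)"
    using assms U by (simp add: compact_diff)
  show "eventually (\<lambda>t. x t \<in> U) F"
  proof (cases "K - U = {}")
    case True
    then show ?thesis
      using in_K by (auto elim: eventually_mono)
  next
    case False
    then obtain y where y: "y \<in> K - U" "\<And>z. z \<in> K - U \<Longrightarrow> p y \<le> p z"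
      using continuous_attains_inf[OF \<open>compact (K - U)\<close>, of p] assms(2)
      by (meson Diff_subset continuous_on_subset)
    then have "p y > 0"
      using assms(3) U by force
    with lim have "eventually (\<lambda>t. p (x t) < p y) F"
      by (rule order_tendstoD)
    with in_K show ?thesis
      by eventually_elim (use y in force)
  qed
qed

text \<open>
  The strong operator topology is pulled back from the space of all functions, where
  convergence is pointwise.
\<close>

lemma converges_strongly_iff:
  "converges_strongly J T P \<longleftrightarrow> (\<forall>f. ((\<lambda>t. T t f) \<longlongrightarrow> P f) (infinity_in J))"
proof -
  have "converges_strongly J T P \<longleftrightarrow> ((\<lambda>t. blinfun_apply (T t)) \<longlongrightarrow> blinfun_apply P) (infinity_in J)"
    unfolding converges_strongly_def limitin_def strong_operator_topology_topspace tendsto_def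
    by (auto simp: strong_operator_topology_def openin_pullback_topology)
  also have "\<dots> \<longleftrightarrow> limitin (product_topology (\<lambda>_. euclidean) UNIV) (\<lambda>t. blinfun_apply (T t)) (blinfun_apply P) (infinity_in J)"
    by (simp add: euclidean_product_topology)
  also have "\<dots> \<longleftrightarrow> (\<forall>f. ((\<lambda>t. T t f) \<longlongrightarrow> P f) (infinity_in J))"
    by (simp add: limitin_componentwise)
  finally show ?thesis .
qed

section \<open>Positive semigroups that are bounded with respect to a functional\<close>

text \<open>
  Discrete times are written \<open>real (Suc n)\<close> throughout, as \<open>0\<close> does not belong to \<open>J\<close>.
\<close>

locale bounded_positive_semigroup =
  fixes J :: "real set" and T :: "real \<Rightarrow> 'a::banach_lattice \<Rightarrow>\<^sub>L 'a"
    and \<psi> :: "'a \<Rightarrow>\<^sub>L real" and M :: real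
  assumes J: "J = \<nat> - {0} \<or> J = {0<..}"
    and positive_semigroup: "positive_semigroup J T"
    and strictly_positive: "strictly_positive_functional \<psi>"
    and M: "0 < M"
    and dual_bound: "t \<in> J \<Longrightarrow> dual_le (dual_operator (T t) \<psi>) (M *\<^sub>R \<psi>)"
begin

lemma J_pos: "t \<in> J \<Longrightarrow> 0 < t"
  using J by (auto simp: Nats_def)

lemma of_nat_in_J: "0 < n \<Longrightarrow> real n \<in> J"
  using J by auto

lemma one_in_J: "1 \<in> J"
  using of_nat_in_J[of 1] by simp

lemma diff_in_J: "s \<in> J \<Longrightarrow> t \<in> J \<Longrightarrow> s < t \<Longrightarrow> t - s \<in> J"
  using J by (auto intro: Nats_diff)

lemma T_add: "s \<in> J \<Longrightarrow> t \<in> J \<Longrightarrow> T (t + s) f = T t (T s f)"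
  using positive_semigroup by (simp add: positive_semigroup_def operator_semigroup_def)

lemma T1_invariant_imp_T_invariant:
  assumes "\<And>f. \<phi> (T 1 f) = \<phi> f"
  shows "\<phi> (T (real (Suc n)) f) = \<phi> f"
proof (induction n arbitrary: f)
  case (Suc n)
  have "\<phi> (T (real (Suc (Suc n))) f) = \<phi> (T (real (Suc n)) (T 1 f))"
    using T_add[OF one_in_J of_nat_in_J[of "Suc n"], of f] by (simp add: add_ac)
  then show ?case
    by (simp add: Suc assms del: of_nat_Suc)
qed (simp add: assms)

lemma positive_T: "t \<in> J \<Longrightarrow> positive_operator (T t)"
  using positive_semigroup by (simp add: positive_semigroup_def)

lemma positive_\<psi>: "positive_operator \<psi>"
  using strictly_positive
  unfolding positive_operator_def strictly_positive_functional_def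
  by (metis blinfun.zero_right less_imp_le order_refl)

lemma \<psi>_abs_nonneg: "0 \<le> \<psi> \<bar>f\<bar>"
  using positive_\<psi> by (simp add: positive_operator_def)

lemma \<psi>_abs_le_0: "\<psi> \<bar>f\<bar> \<le> 0 \<Longrightarrow> f = 0"
  using strictly_positive unfolding strictly_positive_functional_def
  by (metis abs_eq_0 abs_ge_zero not_le)

lemma \<psi>_T_le: "t \<in> J \<Longrightarrow> 0 \<le> f \<Longrightarrow> \<psi> (T t f) \<le> M * \<psi> f"
  using dual_bound by (simp add: dual_le_def dual_operator_def blinfun.scaleR_left)

lemma \<psi>_abs_T_le: "t \<in> J \<Longrightarrow> \<psi> \<bar>T t f\<bar> \<le> M * \<psi> \<bar>f\<bar>"
  using positive_operator_mono[OF positive_\<psi> positive_operator_abs_le[OF positive_T, of t f]]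
    \<psi>_T_le[of t "\<bar>f\<bar>"] by simp

lemma filterlim_of_nat_infinity_in: "filterlim (\<lambda>n. real (Suc n)) (infinity_in J) sequentially"
  unfolding infinity_in_def filterlim_inf filterlim_principal
  using of_nat_in_J
  by (auto simp del: of_nat_Suc intro!: always_eventually
      filterlim_compose[OF filterlim_real_sequentially filterlim_Suc])

lemma eventually_in_J: "eventually (\<lambda>t. t \<in> J) (infinity_in J)"
  by (simp add: infinity_in_def eventually_inf_principal)

text \<open>
  Up to the factor \<open>M\<close>, the value \<open>\<psi> \<bar>T t f\<bar>\<close> cannot grow with \<open>t\<close>, so integer times suffice.
\<close>

lemma \<psi>_abs_tendsto_0:
  assumes "(\<lambda>n. \<psi> \<bar>T (real (Suc n)) f\<bar>) \<longlonglongrightarrow> 0"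
  shows "((\<lambda>t. \<psi> \<bar>T t f\<bar>) \<longlongrightarrow> 0) (infinity_in J)"
proof (rule order_tendstoI)
  fix e :: real assume "0 < e"
  then have "0 < e / M"
    using M by simp
  with assms obtain n where n: "\<psi> \<bar>T (real (Suc n)) f\<bar> < e / M"
    using order_tendstoD(2) eventually_happens'[OF sequentially_bot] by blast
  have "\<psi> \<bar>T t f\<bar> < e" if "t \<in> J" "real (Suc n) < t" for t
  proof -
    have "T t f = T (t - real (Suc n)) (T (real (Suc n)) f)"
      using T_add[OF of_nat_in_J[of "Suc n"] diff_in_J[OF of_nat_in_J that]] by simp
    then have "\<psi> \<bar>T t f\<bar> \<le> M * \<psi> \<bar>T (real (Suc n)) f\<bar>"
      using \<psi>_abs_T_le[OF diff_in_J[OF of_nat_in_J that]] by simp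
    also have "\<dots> < e"
      using n M by (simp add: field_simps)
    finally show ?thesis .
  qed
  then show "eventually (\<lambda>t. \<psi> \<bar>T t f\<bar> < e) (infinity_in J)"
    unfolding infinity_in_def eventually_inf_principal
    by (intro eventually_mono[OF eventually_gt_at_top[of "real (Suc n)"]]) auto
qed (use \<psi>_abs_nonneg in \<open>auto intro: always_eventually less_le_trans\<close>)

lemma tendsto_0_if_\<psi>_abs_tendsto_0:
  assumes "relatively_compact_orbits J T" and "(\<lambda>n. \<psi> \<bar>T (real (Suc n)) f\<bar>) \<longlonglongrightarrow> 0"
  shows "((\<lambda>t. T t f) \<longlongrightarrow> 0) (infinity_in J)"
proof (rule tendsto_if_compact_separated)
  show "compact (closure ((\<lambda>t. T t f) ` J))"
    using assms by (simp add: relatively_compact_orbits_def)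
  show "continuous_on (closure ((\<lambda>t. T t f) ` J)) (\<lambda>f. \<psi> \<bar>f\<bar>)"
    by (intro continuous_intros continuous_on_abs_lattice)
  show "eventually (\<lambda>t. T t f \<in> closure ((\<lambda>t. T t f) ` J)) (infinity_in J)"
    using eventually_in_J by eventually_elim (use closure_subset in force)
qed (use \<psi>_abs_le_0 \<psi>_abs_tendsto_0[OF assms(2)] in auto)

text \<open>
  \<open>\<phi> f\<close> is the Banach limit of \<open>n \<mapsto> \<psi> (T (n + 1) f)\<close>: replacing \<open>f\<close> by \<open>T 1 f\<close> shifts this
  sequence, which gives the invariance, and the two bounds are bounds on all of its terms.
\<close>

lemma invariant_functional_exists:
  obtains \<phi> :: "'a \<Rightarrow>\<^sub>L real" where
    "positive_operator \<phi>"
    "\<And>f. \<phi> (T 1 f) = \<phi> f"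
    "\<And>f. 0 \<le> f \<Longrightarrow> \<phi> f \<le> M * \<psi> f"
    "\<And>f a. (\<And>n. a \<le> \<psi> (T (real (Suc n)) f)) \<Longrightarrow> a \<le> \<phi> f"
proof -
  obtain L :: "(nat \<Rightarrow> real) \<Rightarrow> real" where
    add: "\<And>x y. Bseq x \<Longrightarrow> Bseq y \<Longrightarrow> L (\<lambda>n. x n + y n) = L x + L y"
    and scale: "\<And>c x. Bseq x \<Longrightarrow> L (\<lambda>n. c * x n) = c * L x"
    and shift: "\<And>x. Bseq x \<Longrightarrow> L (\<lambda>n. x (Suc n)) = L x"
    and lower: "\<And>x a. Bseq x \<Longrightarrow> (\<And>n. a \<le> x n) \<Longrightarrow> a \<le> L x"
    using banach_limit_exists by blast
  have upper: "L x \<le> a" if "Bseq x" "\<And>n. x n \<le> a" for x a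
    using lower[of "\<lambda>n. - 1 * x n" "- a"] scale[of x "- 1"] that by (simp add: Bseq_minus_iff)
  define orbit where "orbit f n = \<psi> (T (real (Suc n)) f)" for f n
  have abs_orbit: "\<bar>orbit f n\<bar> \<le> M * \<psi> \<bar>f\<bar>" for f n
    using positive_operator_abs_le[OF positive_\<psi>, of "T (real (Suc n)) f"]
      \<psi>_abs_T_le[OF of_nat_in_J[of "Suc n"], of f]
    unfolding orbit_def by linarith
  then have Bseq_orbit: "Bseq (orbit f)" for f
    by (intro BseqI') simp
  define \<phi>' where "\<phi>' f = L (orbit f)" for f
  have "bounded_linear \<phi>'"
  proof (rule bounded_linear_intro)
    show "\<phi>' (f + g) = \<phi>' f + \<phi>' g" for f g
      using add[OF Bseq_orbit Bseq_orbit, of f g]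
      by (simp add: \<phi>'_def orbit_def[abs_def] blinfun.add_right)
    show "\<phi>' (c *\<^sub>R f) = c *\<^sub>R \<phi>' f" for c f
      using scale[OF Bseq_orbit, of c f] by (simp add: \<phi>'_def orbit_def[abs_def] blinfun.scaleR_right)
    show "norm (\<phi>' f) \<le> norm f * (M * norm \<psi>)" for f
    proof -
      have "\<bar>\<phi>' f\<bar> \<le> M * \<psi> \<bar>f\<bar>"
        using lower[OF Bseq_orbit, of "- (M * \<psi> \<bar>f\<bar>)" f] upper[OF Bseq_orbit, of f "M * \<psi> \<bar>f\<bar>"] abs_orbit[of f]
        unfolding \<phi>'_def by (simp add: abs_le_iff minus_le_iff)
      also have "\<dots> \<le> M * (norm \<psi> * norm f)"
        using M norm_blinfun[of \<psi> "\<bar>f\<bar>"] by (simp add: norm_abs_lattice)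
      finally show ?thesis
        by (simp add: mult_ac)
    qed
  qed
  then have \<phi>': "blinfun_apply (Blinfun \<phi>') = \<phi>'"
    by (rule bounded_linear_Blinfun_apply)
  show thesis
  proof (rule that[of "Blinfun \<phi>'"], unfold \<phi>')
    have "0 \<le> \<phi>' f" if "0 \<le> f" for f
      using that positive_\<psi> positive_T[OF of_nat_in_J[of "Suc _"]]
      unfolding \<phi>'_def by (intro lower Bseq_orbit) (simp add: orbit_def positive_operator_def del: of_nat_Suc)
    then show "positive_operator (Blinfun \<phi>')"
      by (simp add: positive_operator_def \<phi>')
    show "\<phi>' (T 1 f) = \<phi>' f" for f
    proof -
      have "orbit (T 1 f) n = orbit f (Suc n)" for n
        using T_add[OF one_in_J of_nat_in_J[of "Suc n"], of f]
        by (simp add: orbit_def add_ac)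
      then have "orbit (T 1 f) = (\<lambda>n. orbit f (Suc n))"
        by (rule ext)
      then show ?thesis
        unfolding \<phi>'_def by (simp add: shift[OF Bseq_orbit])
    qed
    show "\<phi>' f \<le> M * \<psi> f" if "0 \<le> f" for f
      unfolding \<phi>'_def using that \<psi>_T_le[OF of_nat_in_J[of "Suc _"]]
      by (intro upper Bseq_orbit) (simp add: orbit_def del: of_nat_Suc)
    show "a \<le> \<phi>' f" if "\<And>n. a \<le> \<psi> (T (real (Suc n)) f)" for f a
      unfolding \<phi>'_def using that by (intro lower Bseq_orbit) (simp add: orbit_def)
  qed
qed

end

section \<open>Semigroups with a lower bound\<close>

locale lower_bound_semigroup = bounded_positive_semigroup J T \<psi> M
  for J and T :: "real \<Rightarrow> 'a::banach_lattice \<Rightarrow>\<^sub>L 'a" and \<psi> M +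
  fixes h :: 'a
  assumes lower_bound: "lower_bound J T \<psi> h" and h_neq_0: "h \<noteq> 0"
begin

lemma h_nonneg: "0 \<le> h"
  using lower_bound by (simp add: lower_bound_def)

text \<open>
  Homogeneity removes the normalisation \<open>\<psi> f = 1\<close> from the definition of a lower bound.
\<close>

lemma lower_bound_scaled:
  assumes "0 \<le> f"
  shows "(\<lambda>n. \<psi> (neg_part (T (real (Suc n)) f - \<psi> f *\<^sub>R h))) \<longlonglongrightarrow> 0"
proof (cases "f = 0")
  case True
  then show ?thesis
    by (simp add: neg_part_def)
next
  case False
  then have pos: "0 < \<psi> f"
    using assms strictly_positive by (simp add: strictly_positive_functional_def)
  define u where "u = (1 / \<psi> f) *\<^sub>R f"
  have "0 \<le> u" "\<psi> u = 1"
    using assms pos by (simp_all add: u_def scaleR_nonneg_nonneg blinfun.scaleR_right)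
  then have "((\<lambda>t. \<psi> (neg_part (T t u - h))) \<longlongrightarrow> 0) (infinity_in J)"
    using lower_bound by (simp add: lower_bound_def)
  then have "(\<lambda>n. \<psi> (neg_part (T (real (Suc n)) u - h))) \<longlonglongrightarrow> 0"
    by (rule filterlim_compose[OF _ filterlim_of_nat_infinity_in])
  then have "(\<lambda>n. \<psi> f * \<psi> (neg_part (T (real (Suc n)) u - h))) \<longlonglongrightarrow> 0"
    by (rule tendsto_mult_right_zero)
  moreover have "\<psi> f *\<^sub>R (T t u - h) = T t f - \<psi> f *\<^sub>R h" for t
    using pos by (simp add: u_def blinfun.scaleR_right scaleR_diff_right)
  then have "\<psi> f * \<psi> (neg_part (T t u - h)) = \<psi> (neg_part (T t f - \<psi> f *\<^sub>R h))" for t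
    using neg_part_scaleR[OF pos, of "T t u - h"] by (simp add: blinfun.scaleR_right)
  ultimately show ?thesis
    by simp
qed

text \<open>
  Applied to \<open>h\<close> itself, the lower bound gives \<open>\<psi> (T n h) \<ge> (\<psi> h)\<^sup>2 / 2\<close> for large \<open>n\<close>, say
  from \<open>N\<close> on. As \<open>\<phi>\<close> is bounded below only by lower bounds on complete orbits, this is used
  for the orbit of \<open>T (N + 1) h\<close>, on which \<open>\<phi>\<close> has the same value as on \<open>h\<close>.
\<close>

lemma nonzero_invariant_functional_exists:
  obtains \<phi> :: "'a \<Rightarrow>\<^sub>L real" where
    "positive_operator \<phi>"
    "\<And>f. \<phi> (T 1 f) = \<phi> f"
    "\<And>f. 0 \<le> f \<Longrightarrow> \<phi> f \<le> M * \<psi> f"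
    "0 < \<phi> h"
proof -
  obtain \<phi> :: "'a \<Rightarrow>\<^sub>L real" where pos: "positive_operator \<phi>"
    and inv: "\<And>f. \<phi> (T 1 f) = \<phi> f"
    and upper: "\<And>f. 0 \<le> f \<Longrightarrow> \<phi> f \<le> M * \<psi> f"
    and lower: "\<And>f a. (\<And>n. a \<le> \<psi> (T (real (Suc n)) f)) \<Longrightarrow> a \<le> \<phi> f"
    using invariant_functional_exists by blast
  have "0 < \<psi> h"
    using h_nonneg h_neq_0 strictly_positive by (simp add: strictly_positive_functional_def)
  define d where "d = \<psi> h * \<psi> h / 2"
  have "0 < d"
    using \<open>0 < \<psi> h\<close> by (simp add: d_def)
  with lower_bound_scaled[OF h_nonneg]
  have "eventually (\<lambda>n. \<psi> (neg_part (T (real (Suc n)) h - \<psi> h *\<^sub>R h)) < d) sequentially"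
    by (rule order_tendstoD)
  then obtain N where N: "\<psi> (neg_part (T (real (Suc n)) h - \<psi> h *\<^sub>R h)) < d" if "N \<le> n" for n
    unfolding eventually_sequentially by blast
  have "d \<le> \<psi> (T (real (Suc n)) h)" if "N \<le> n" for n
    using positive_operator_mono[OF positive_\<psi> uminus_neg_part_le, of "T (real (Suc n)) h - \<psi> h *\<^sub>R h"] N[OF that]
    by (simp add: d_def blinfun.minus_right blinfun.diff_right blinfun.scaleR_right del: of_nat_Suc)
  then have "d \<le> \<psi> (T (real (Suc n)) (T (real (Suc N)) h))" for n
    using T_add[OF of_nat_in_J[of "Suc N"] of_nat_in_J[of "Suc n"], of h, symmetric]
    by (simp add: add_ac flip: of_nat_add of_nat_Suc)
  then have "d \<le> \<phi> (T (real (Suc N)) h)"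
    by (rule lower)
  then have "d \<le> \<phi> h"
    by (simp only: T1_invariant_imp_T_invariant[of \<phi>, OF inv])
  then show thesis
    using \<open>0 < d\<close> pos inv upper by (intro that) auto
qed

section \<open>Lasota's lower bound argument\<close>

context
  fixes \<phi> :: "'a \<Rightarrow>\<^sub>L real"
  assumes \<phi>: "positive_operator \<phi>"
    and \<phi>_T1: "\<And>f. \<phi> (T 1 f) = \<phi> f"
    and \<phi>_upper: "\<And>f. 0 \<le> f \<Longrightarrow> \<phi> f \<le> M * \<psi> f"
    and \<phi>_h: "0 < \<phi> h"
begin

lemma \<phi>_T: "\<phi> (T (real (Suc n)) f) = \<phi> f"
  by (rule T1_invariant_imp_T_invariant[of \<phi>, OF \<phi>_T1])

lemma \<phi>_nonneg: "0 \<le> f \<Longrightarrow> 0 \<le> \<phi> f"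
  using \<phi> by (simp add: positive_operator_def)

lemma \<phi>_lower_bound_scaled:
  assumes "0 \<le> f"
  shows "(\<lambda>n. \<phi> (neg_part (T (real (Suc n)) f - \<psi> f *\<^sub>R h))) \<longlonglongrightarrow> 0"
proof (rule tendsto_sandwich[where f = "\<lambda>_. 0", rotated 3])
  show "(\<lambda>n. M * \<psi> (neg_part (T (real (Suc n)) f - \<psi> f *\<^sub>R h))) \<longlonglongrightarrow> 0"
    by (intro tendsto_mult_right_zero lower_bound_scaled assms)
qed (auto intro!: always_eventually \<phi>_nonneg \<phi>_upper neg_part_nonneg)

text \<open>
  Together with \<open>\<phi> \<le> M \<psi>\<close> this makes the norms \<open>f \<mapsto> \<phi> \<bar>f\<bar>\<close> and \<open>f \<mapsto> \<psi> \<bar>f\<bar>\<close> equivalent. It is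
  the limit of the lower bound for \<open>T n f\<close>, because \<open>\<phi> (T n f)\<close> does not depend on \<open>n\<close>.
\<close>

lemma \<phi>_lower:
  assumes "0 \<le> f"
  shows "\<psi> f * \<phi> h \<le> \<phi> f"
proof -
  have "(\<lambda>n. \<psi> f * \<phi> h - \<phi> (neg_part (T (real (Suc n)) f - \<psi> f *\<^sub>R h))) \<longlonglongrightarrow> \<psi> f * \<phi> h - 0"
    by (intro tendsto_intros \<phi>_lower_bound_scaled assms)
  moreover have "\<psi> f * \<phi> h - \<phi> (neg_part (T (real (Suc n)) f - \<psi> f *\<^sub>R h)) \<le> \<phi> f" for n
    using positive_operator_mono[OF \<phi> uminus_neg_part_le, of "T (real (Suc n)) f - \<psi> f *\<^sub>R h"]
      \<phi>_T[of n f]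
    by (simp add: blinfun.minus_right blinfun.diff_right blinfun.scaleR_right)
  ultimately show ?thesis
    using LIMSEQ_le_const2 by fastforce
qed

lemma \<phi>_abs_T_Suc_le: "\<phi> \<bar>T (real (Suc (Suc n))) f\<bar> \<le> \<phi> \<bar>T (real (Suc n)) f\<bar>"
proof -
  have "T (real (Suc (Suc n))) f = T 1 (T (real (Suc n)) f)"
    using T_add[OF of_nat_in_J[of "Suc n"] one_in_J, of f] by simp
  then have "\<phi> \<bar>T (real (Suc (Suc n))) f\<bar> \<le> \<phi> (T 1 \<bar>T (real (Suc n)) f\<bar>)"
    by (simp add: one_in_J positive_operator_mono[OF \<phi>] positive_operator_abs_le positive_T del: of_nat_Suc)
  then show ?thesis
    by (simp add: \<phi>_T1)
qed

text \<open>
  The identity \<open>\<bar>v\<bar> = v + 2 v\<^sup>-\<close> expresses the mass of \<open>\<bar>T n u - (\<phi> u / M) h\<bar>\<close> through that of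
  \<open>u\<close>, which is preserved, and a negative part, which the lower bound makes small. The
  coefficient \<open>\<phi> u / M \<le> \<psi> u\<close> replaces \<open>\<psi> u\<close> in order to depend on the mass \<open>\<phi> u\<close> only: so
  it is the same for the positive and the negative part of a vector \<open>f\<close> with \<open>\<phi> f = 0\<close>.
\<close>

lemma \<phi>_abs_T_minus_lower_bound_le:
  assumes "0 \<le> u"
  shows "\<phi> \<bar>T (real (Suc n)) u - (\<phi> u / M) *\<^sub>R h\<bar>
    \<le> (1 - \<phi> h / M) * \<phi> u + 2 * \<phi> (neg_part (T (real (Suc n)) u - \<psi> u *\<^sub>R h))"
proof -
  have "(\<phi> u / M) *\<^sub>R h \<le> \<psi> u *\<^sub>R h"
    using \<phi>_upper[OF assms] M h_nonneg by (intro scaleR_right_mono) (simp_all add: field_simps)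
  then have "\<phi> (neg_part (T (real (Suc n)) u - (\<phi> u / M) *\<^sub>R h))
      \<le> \<phi> (neg_part (T (real (Suc n)) u - \<psi> u *\<^sub>R h))"
    by (intro positive_operator_mono[OF \<phi>] neg_part_antimono diff_left_mono)
  moreover have "\<phi> \<bar>T (real (Suc n)) u - (\<phi> u / M) *\<^sub>R h\<bar>
    = (1 - \<phi> h / M) * \<phi> u + 2 * \<phi> (neg_part (T (real (Suc n)) u - (\<phi> u / M) *\<^sub>R h))"
    unfolding abs_eq_add_neg_part
    by (simp add: blinfun.add_right blinfun.diff_right blinfun.scaleR_right \<phi>_T algebra_simps del: of_nat_Suc)
  ultimately show ?thesis
    by simp
qed

text \<open>
  Lasota's estimate: the two parts of \<open>f\<close> have equal mass, so the same multiple of \<open>h\<close> may be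
  subtracted from both orbits, and it cancels in their difference \<open>T n f\<close>.
\<close>

lemma \<phi>_abs_T_contraction:
  assumes "\<phi> f = 0" and lim: "(\<lambda>n. \<phi> \<bar>T (real (Suc n)) f\<bar>) \<longlonglongrightarrow> l"
  shows "l \<le> (1 - \<phi> h / M) * \<phi> \<bar>f\<bar>"
proof -
  let ?u = "pprt f" and ?v = "pprt (- f)"
  let ?e = "\<lambda>u n. \<phi> (neg_part (T (real (Suc n)) u - \<psi> u *\<^sub>R h))"
  have f: "f = ?u - ?v" and abs_f: "\<bar>f\<bar> = ?u + ?v"
    by (rule eq_pprt_diff_pprt_uminus abs_eq_pprt_add_pprt_uminus)+
  have eq: "\<phi> ?u = \<phi> ?v"
    using assms(1) f by (metis blinfun.diff_right right_minus_eq)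
  have le: "\<phi> \<bar>T (real (Suc n)) f\<bar> \<le> (1 - \<phi> h / M) * \<phi> \<bar>f\<bar> + 2 * ?e ?u n + 2 * ?e ?v n" for n
  proof -
    have "T (real (Suc n)) f = (T (real (Suc n)) ?u - (\<phi> ?u / M) *\<^sub>R h) - (T (real (Suc n)) ?v - (\<phi> ?v / M) *\<^sub>R h)"
      by (subst f) (simp add: blinfun.diff_right eq)
    then have "\<bar>T (real (Suc n)) f\<bar>
        \<le> \<bar>T (real (Suc n)) ?u - (\<phi> ?u / M) *\<^sub>R h\<bar> + \<bar>T (real (Suc n)) ?v - (\<phi> ?v / M) *\<^sub>R h\<bar>"
      by (metis abs_triangle_ineq4)
    from positive_operator_mono[OF \<phi> this]
    have "\<phi> \<bar>T (real (Suc n)) f\<bar>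
        \<le> \<phi> \<bar>T (real (Suc n)) ?u - (\<phi> ?u / M) *\<^sub>R h\<bar> + \<phi> \<bar>T (real (Suc n)) ?v - (\<phi> ?v / M) *\<^sub>R h\<bar>"
      by (simp add: blinfun.add_right)
    also have "\<dots> \<le> ((1 - \<phi> h / M) * \<phi> ?u + 2 * ?e ?u n) + ((1 - \<phi> h / M) * \<phi> ?v + 2 * ?e ?v n)"
      by (intro add_mono \<phi>_abs_T_minus_lower_bound_le zero_le_pprt)
    also have "\<dots> = (1 - \<phi> h / M) * \<phi> \<bar>f\<bar> + 2 * ?e ?u n + 2 * ?e ?v n"
      unfolding abs_f by (simp add: blinfun.add_right distrib_left)
    finally show ?thesis .
  qed
  have "(\<lambda>n. (1 - \<phi> h / M) * \<phi> \<bar>f\<bar> + 2 * ?e ?u n + 2 * ?e ?v n)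
      \<longlonglongrightarrow> (1 - \<phi> h / M) * \<phi> \<bar>f\<bar> + 2 * 0 + 2 * 0"
    by (intro tendsto_intros \<phi>_lower_bound_scaled zero_le_pprt)
  with lim show ?thesis
    using le by (intro LIMSEQ_le[where Y = "\<lambda>n. (1 - \<phi> h / M) * \<phi> \<bar>f\<bar> + 2 * ?e ?u n + 2 * ?e ?v n"]) auto
qed

text \<open>
  The limit \<open>l\<close> of \<open>\<phi> \<bar>T n f\<bar>\<close> is the same for all vectors \<open>T m f\<close> of the orbit, and their masses
  tend to \<open>l\<close> as well. Thus the previous estimate bounds \<open>l\<close> by a proper fraction of itself.
\<close>

lemma \<psi>_abs_T_tendsto_0:
  assumes "\<phi> f = 0"
  shows "(\<lambda>n. \<psi> \<bar>T (real (Suc n)) f\<bar>) \<longlonglongrightarrow> 0"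
proof -
  define d where "d n = \<phi> \<bar>T (real (Suc n)) f\<bar>" for n
  have "decseq d"
    unfolding d_def using \<phi>_abs_T_Suc_le by (intro decseq_SucI)
  have d_nonneg: "0 \<le> d n" for n
    by (simp add: d_def \<phi>_nonneg)
  obtain l where l: "d \<longlonglongrightarrow> l"
    using decseq_convergent[OF \<open>decseq d\<close>, of 0] d_nonneg by blast
  have "l \<le> (1 - \<phi> h / M) * d m" for m
  proof -
    have "T (real (Suc n)) (T (real (Suc m)) f) = T (real (Suc (n + Suc m))) f" for n
      using T_add[OF of_nat_in_J[of "Suc m"] of_nat_in_J[of "Suc n"], of f, symmetric]
      by (simp add: add_ac)
    then have "(\<lambda>n. \<phi> \<bar>T (real (Suc n)) (T (real (Suc m)) f)\<bar>) \<longlonglongrightarrow> l"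
      using LIMSEQ_ignore_initial_segment[OF l, of "Suc m"] by (simp add: d_def[abs_def] del: of_nat_Suc)
    then show ?thesis
      unfolding d_def using assms by (intro \<phi>_abs_T_contraction) (simp_all add: \<phi>_T del: of_nat_Suc)
  qed
  then have "l \<le> (1 - \<phi> h / M) * l"
    by (intro LIMSEQ_le_const[OF tendsto_mult_left[OF l]]) auto
  then have "\<phi> h * l \<le> 0"
    using M by (simp add: field_simps)
  then have "l = 0"
    using \<phi>_h LIMSEQ_le_const[OF l, of 0] d_nonneg by (auto simp: mult_le_0_iff intro: antisym)
  then have "(\<lambda>n. d n / \<phi> h) \<longlonglongrightarrow> 0"
    using tendsto_divide[OF l tendsto_const[of "\<phi> h"]] \<phi>_h by simp
  then show ?thesis
  proof (rule tendsto_sandwich[where f = "\<lambda>_. 0", rotated 3])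
    show "eventually (\<lambda>n. \<psi> \<bar>T (real (Suc n)) f\<bar> \<le> d n / \<phi> h) sequentially"
      using \<phi>_lower[OF abs_ge_zero] \<phi>_h
      by (intro always_eventually) (simp add: d_def field_simps del: of_nat_Suc)
  qed (simp_all add: \<psi>_abs_nonneg)
qed

lemma T_tendsto_0:
  assumes "relatively_compact_orbits J T" and "\<phi> f = 0"
  shows "((\<lambda>t. T t f) \<longlongrightarrow> 0) (infinity_in J)"
  by (intro tendsto_0_if_\<psi>_abs_tendsto_0 \<psi>_abs_T_tendsto_0 assms)

section \<open>Fixed vectors\<close>

text \<open>
  Any cluster point \<open>g\<close> of \<open>T n h\<close> is fixed by \<open>T 1\<close>: since \<open>\<phi> (T 1 h - h) = 0\<close>, the orbit of
  \<open>T 1 h - h\<close> tends to \<open>0\<close>, while along a suitable subsequence it tends to \<open>T 1 g - g\<close>.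
\<close>

lemma fixed_vector_of_natural_times_exists:
  assumes compact: "relatively_compact_orbits J T"
  obtains g where "\<phi> g = \<phi> h" "\<And>n. T (real (Suc n)) g = g"
proof -
  let ?K = "closure ((\<lambda>t. T t h) ` J)"
  have "seq_compact ?K"
    using compact by (simp add: relatively_compact_orbits_def compact_imp_seq_compact)
  moreover have "\<forall>n. T (real (Suc n)) h \<in> ?K"
    by (intro allI subsetD[OF closure_subset] image_eqI[OF refl] of_nat_in_J) simp
  ultimately obtain g r where r: "strict_mono (r :: nat \<Rightarrow> nat)"
    and g: "((\<lambda>n. T (real (Suc n)) h) \<circ> r) \<longlonglongrightarrow> g"
    by (rule seq_compactE)
  from g have g: "(\<lambda>n. T (real (Suc (r n))) h) \<longlonglongrightarrow> g"
    by (simp only: o_def)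
  have along_r: "filterlim (\<lambda>n. real (Suc (r n))) (infinity_in J) sequentially"
    by (rule filterlim_compose[OF filterlim_of_nat_infinity_in filterlim_subseq[OF r]])
  have "(\<lambda>n. T (real (Suc (r n))) (T 1 h - h)) \<longlonglongrightarrow> 0"
    by (rule filterlim_compose[OF T_tendsto_0[OF compact] along_r]) (simp add: blinfun.diff_right \<phi>_T1)
  moreover have "T (real (Suc (r n))) (T 1 h - h) = T 1 (T (real (Suc (r n))) h) - T (real (Suc (r n))) h" for n
    using T_add[OF one_in_J of_nat_in_J[of "Suc (r n)"], of h]
      T_add[OF of_nat_in_J[of "Suc (r n)"] one_in_J, of h]
    by (simp add: blinfun.diff_right add_ac)
  moreover have "(\<lambda>n. T 1 (T (real (Suc (r n))) h) - T (real (Suc (r n))) h) \<longlonglongrightarrow> T 1 g - g"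
    by (intro tendsto_intros g)
  ultimately have "T 1 g - g = 0"
    using LIMSEQ_unique by fastforce
  then have "T (real (Suc n)) g = g" for n
  proof (induction n)
    case (Suc n)
    then show ?case
      using T_add[OF of_nat_in_J[of "Suc n"] one_in_J, of g] by (simp add: add_ac)
  qed simp
  moreover have "\<phi> g = \<phi> h"
  proof (rule LIMSEQ_unique)
    show "(\<lambda>n. \<phi> (T (real (Suc (r n))) h)) \<longlonglongrightarrow> \<phi> g"
      by (intro tendsto_intros g)
  qed (simp add: \<phi>_T del: of_nat_Suc)
  ultimately show thesis
    by (intro that)
qed

text \<open>
  For arbitrary times, \<open>T t g\<close> is first seen to be a multiple \<open>c t\<close> of \<open>g\<close>. In continuous time
  \<open>c t = (c (t / 2))\<^sup>2 \<ge> 0\<close>, and \<open>c t \<le> 1\<close> because the powers of \<open>c t\<close> are bounded. As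
  \<open>c t c (N - t) = c N = 1\<close> for an integer \<open>N > t\<close>, both factors equal \<open>1\<close>.
\<close>

lemma fixed_vector_exists:
  assumes compact: "relatively_compact_orbits J T"
  obtains g where "0 < \<phi> g" "\<And>t. t \<in> J \<Longrightarrow> T t g = g"
proof -
  obtain g where g: "\<phi> g = \<phi> h" and fixed: "\<And>n. T (real (Suc n)) g = g"
    using fixed_vector_of_natural_times_exists[OF compact] by blast
  have pos: "0 < \<phi> g"
    using \<phi>_h g by simp
  define c where "c t = \<phi> (T t g) / \<phi> g" for t
  have T_g: "T t g = c t *\<^sub>R g" if "t \<in> J" for t
  proof -
    let ?f = "T t g - c t *\<^sub>R g"
    have "\<phi> ?f = 0"
      using pos by (simp add: c_def blinfun.diff_right blinfun.scaleR_right)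
    then have "(\<lambda>n. T (real (Suc n)) ?f) \<longlonglongrightarrow> 0"
      by (intro filterlim_compose[OF T_tendsto_0[OF compact] filterlim_of_nat_infinity_in])
    moreover have "T (real (Suc n)) ?f = ?f" for n
      using T_add[OF that of_nat_in_J[of "Suc n"], of g] T_add[OF of_nat_in_J[of "Suc n"] that, of g] fixed[of n]
      by (simp add: blinfun.diff_right blinfun.scaleR_right add_ac)
    ultimately show ?thesis
      by (simp add: LIMSEQ_const_iff)
  qed
  have c_add: "c (s + t) = c s * c t" if "s \<in> J" "t \<in> J" for s t
    using T_add[OF that(2,1), of g] pos
    by (simp add: c_def[of "s + t"] T_g that blinfun.scaleR_right)
  have c_nat: "c (real (Suc n)) = 1" for n
    using fixed[of n] pos by (simp add: c_def)
  have "c t = 1" if t: "t \<in> J" for t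
  proof (cases "J = {0<..}")
    case False
    then have "t \<in> \<nat>" "0 < t"
      using J t J_pos by auto
    then show ?thesis
      using c_nat by (metis Nats_cases gr0_conv_Suc of_nat_0_less_iff)
  next
    case True
    have nonneg: "0 \<le> c s" if "s \<in> J" for s
      using c_add[of "s / 2" "s / 2"] that True by simp
    have le_1: "c s \<le> 1" if "s \<in> J" for s
    proof (rule ccontr)
      assume "\<not> c s \<le> 1"
      have mult: "real (Suc n) * s \<in> J" for n
        using that True by simp
      have power: "c (real (Suc n) * s) = c s ^ Suc n" for n
      proof (induction n)
        case (Suc n)
        then show ?case
          using c_add[OF that mult[of n]] by (simp add: algebra_simps)
      qed simp
      have "c s ^ Suc n * \<psi> \<bar>g\<bar> \<le> M * \<psi> \<bar>g\<bar>" for n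
      proof -
        have "\<bar>T (real (Suc n) * s) g\<bar> = c s ^ Suc n *\<^sub>R \<bar>g\<bar>"
          unfolding T_g[OF mult] power using \<open>\<not> c s \<le> 1\<close>
          by (intro abs_scaleR_pos zero_less_power) simp
        then show ?thesis
          using \<psi>_abs_T_le[OF mult[of n], of g] by (simp add: blinfun.scaleR_right)
      qed
      moreover have "0 < \<psi> \<bar>g\<bar>"
        using \<psi>_abs_le_0[of g] pos by (metis blinfun.zero_right less_irrefl not_le)
      ultimately have "c s ^ Suc n \<le> M" for n
        by (meson mult_le_cancel_right_pos)
      moreover obtain n where "M < c s ^ n"
        using real_arch_pow[of "c s" M] \<open>\<not> c s \<le> 1\<close> by auto
      moreover have "c s ^ n \<le> c s ^ Suc n"
        using \<open>\<not> c s \<le> 1\<close> by (intro power_increasing) auto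
      ultimately show False
        by (meson not_le order_trans)
    qed
    obtain n where n: "t < real (Suc n)"
      using reals_Archimedean2[of t] by (metis less_SucI of_nat_less_iff order.strict_trans lessI)
    let ?s = "real (Suc n) - t"
    have s: "?s \<in> J"
      using n True by simp
    have "c t * c ?s = 1"
      using c_add[OF t s] c_nat[of n] by simp
    moreover have "c t * c ?s \<le> c t * 1"
      using nonneg[OF t] le_1[OF s] by (intro mult_left_mono)
    ultimately show ?thesis
      using le_1[OF t] by simp
  qed
  then show thesis
    using that[of g] pos T_g by simp
qed

end

section \<open>Convergence to a rank-one projection\<close>

lemma tendsto_rank_one_projection:
  assumes "relatively_compact_orbits J T"
  obtains P where "rank_one_projection P" "\<And>f. ((\<lambda>t. T t f) \<longlongrightarrow> P f) (infinity_in J)"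
proof -
  obtain \<phi> :: "'a \<Rightarrow>\<^sub>L real" where \<phi>: "positive_operator \<phi>" "\<And>f. \<phi> (T 1 f) = \<phi> f"
    "\<And>f. 0 \<le> f \<Longrightarrow> \<phi> f \<le> M * \<psi> f" "0 < \<phi> h"
    using nonzero_invariant_functional_exists by blast
  obtain g where pos: "0 < \<phi> g" and fixed: "\<And>t. t \<in> J \<Longrightarrow> T t g = g"
    using fixed_vector_exists[OF \<phi> assms] by blast
  define P where "P = Blinfun (\<lambda>f. (\<phi> f / \<phi> g) *\<^sub>R g)"
  have "bounded_linear (\<lambda>f. (\<phi> f / \<phi> g) *\<^sub>R g)"
    by (intro bounded_linear_scaleR_const bounded_linear_divide[THEN bounded_linear_compose] blinfun.bounded_linear_right)
  then have P: "P f = (\<phi> f / \<phi> g) *\<^sub>R g" for f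
    by (simp add: P_def bounded_linear_Blinfun_apply)
  have "P o\<^sub>L P = P"
    using pos by (intro blinfun_eqI) (simp add: P blinfun.scaleR_right)
  moreover have "range P = span {g}"
  proof
    have "c *\<^sub>R g = P (c *\<^sub>R g)" for c
      using pos by (simp add: P blinfun.scaleR_right)
    then show "span {g} \<subseteq> range P"
      unfolding span_singleton by (metis image_subsetI rangeI)
  qed (auto simp: span_singleton P)
  moreover have "dim {g} = 1"
    using pos dim_eq_card_independent[of "{g}"] by (cases "g = 0") simp_all
  ultimately have "rank_one_projection P"
    by (simp add: rank_one_projection_def)
  moreover have "((\<lambda>t. T t f) \<longlongrightarrow> P f) (infinity_in J)" for f
  proof -
    have "\<phi> (f - P f) = 0"
      using pos by (simp add: P blinfun.diff_right blinfun.scaleR_right)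
    then have "((\<lambda>t. T t (f - P f)) \<longlongrightarrow> 0) (infinity_in J)"
      by (intro T_tendsto_0[OF \<phi> assms])
    then have "((\<lambda>t. T t (f - P f) + P f) \<longlongrightarrow> 0 + P f) (infinity_in J)"
      by (intro tendsto_intros)
    then have "((\<lambda>t. T t (f - P f) + P f) \<longlongrightarrow> P f) (infinity_in J)"
      by simp
    moreover have "eventually (\<lambda>t. T t (f - P f) + P f = T t f) (infinity_in J)"
      using eventually_in_J
      by eventually_elim (simp add: P blinfun.diff_right blinfun.scaleR_right fixed)
    ultimately show ?thesis
      by (rule Lim_transform_eventually)
  qed
  ultimately show thesis
    by (rule that)
qed

end

theorem proposition6p7:
  fixes T :: "real \<Rightarrow> 'a::banach_lattice \<Rightarrow>\<^sub>L 'a"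
    and J :: "real set"
    and \<psi> :: "'a \<Rightarrow>\<^sub>L real"
    and M :: real
    and h :: 'a
  assumes "J = \<nat> - {0} \<or> J = {0<..}"
    and "positive_semigroup J T"
    and "dual_le 0 \<psi>"
    and "strictly_positive_functional \<psi>"
    and "M > 0"
    and "\<And>t. t \<in> J \<Longrightarrow> dual_le (dual_operator (T t) \<psi>) (M *\<^sub>R \<psi>)"
    and "relatively_compact_orbits J T"
    and "lower_bound J T \<psi> h"
    and "h \<noteq> 0"
  shows "\<exists>P. rank_one_projection P \<and> converges_strongly J T P"
proof -
  interpret lower_bound_semigroup J T \<psi> M h
    using assms by unfold_locales
  show ?thesis
    using tendsto_rank_one_projection[OF assms(7)] unfolding converges_strongly_iff by metis
qed

end
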